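(* Fix a positive integer $n$ and assume that, for $i=1,\ldots,n$, we are given a pair $(p_i,\sigma_i^2)$, with $p_i\in(0,1)$ and $\sigma_i>0$, for which the class $\mathcal{B}(p_i,\sigma_i^2)$ is non-empty. Let $X_1,\ldots,X_n$ be independent random variables such that $X_i\in\mathcal{B}(p_i,\sigma_i^2)$ for $i=1,\ldots,n$. Set $p=\frac1n\sum_{i=1}^n\mathbb{E}[X_i]$ and fix $t$ such that $np<t<n$. Then $$\mathbb{P}\left[\sum_{i=1}^n X_i\ge t\right]\le\inf_{f\in\mathcal{F}_{ic}(t)}\frac{1}{f(t)}\mathbb{E}\left[f\left(\sum_{i=1}^n\xi_{p_i,\sigma_i}\right)\right],$$ where $\xi_{p_1,\sigma_1},\ldots,\xi_{p_n,\sigma_n}$ are independent random variables with the distributions $\xi_{p,\sigma}$ given in the context. Furthermore, the infimum on the right hand side is attained by a function of the form $x\mapsto\frac{1}{t-\varepsilon}\max\{0,x-\varepsilon\}$, for some $\varepsilon\in[0,t)$.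
   Context: $\mathcal{B}(p,\sigma^2)$ is the class of all random variables $X$ with $0\le X\le1$, $\mathbb{E}[X]=p$ and $\mathrm{Var}(X)=\sigma^2$; non-emptiness forces $\sigma^2\le p(1-p)$. For fixed $t>0$, $\mathcal{F}_{ic}(t)$ is the set of all convex functions $f:[0,\infty)\to[0,\infty)$ that are increasing (in the sense of nondecreasing) on $[t,\infty)$; the infimum is over those $f\in\mathcal{F}_{ic}(t)$ with $f(t)>0$. For $p\in(0,1)$ and $\sigma>0$ with $\sigma^2\le p(1-p)$, the random variable $\xi_{p,\sigma}$ takes values in $\{0,p,1\}$ and has the following distribution. (i) If $\sigma>1-p$: it takes the values $0,p,1$ with probabilities $\frac{\sigma^2-p\sigma^2}{p((1-p)^2+\sigma^2)}$, $\frac{(1-p)((1-p)p-\sigma^2)}{p((1-p)^2+\sigma^2)}$, $\frac{\sigma^2}{(1-p)^2+\sigma^2}$, respectively. (ii) If $\sigma>p$: it takes the values $0,p,1$ with probabilities $\frac{\sigma^2}{p^2+\sigma^2}$, $\frac{p((1-p)p-\sigma^2)}{(1-p)(p^2+\sigma^2)}$, $\frac{p\sigma^2}{(1-p)(p^2+\sigma^2)}$, respectively. (iii) If $\sigma\le\min\{p,1-p\}$: it takes the values $0,p,1$ with probabilities $\frac{\sigma}{2p}$, $1-\frac{\sigma}{2(1-p)p}$, $\frac{\sigma}{2-2p}$, respectively. (Cases (i) and (ii) cannot both occur, since $\sigma^2\le p(1-p)$.) *)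

theory Defs
  imports "HOL-Probability.Probability"
begin

definition class_B :: "'a measure \<Rightarrow> real \<Rightarrow> real \<Rightarrow> ('a \<Rightarrow> real) set" where
  "class_B M p v = {X. X \<in> borel_measurable M \<and> (AE \<omega> in M. 0 \<le> X \<omega> \<and> X \<omega> \<le> 1) \<and>
     prob_space.expectation M X = p \<and> prob_space.variance M X = v}"

text \<open>
  The functions of the paper have domain and codomain \<open>[0,\<infinity>)\<close>; here they are total functions on the
  reals whose values on the negative half-line are unconstrained.
\<close>

definition F_ic :: "real \<Rightarrow> (real \<Rightarrow> real) set" where
  "F_ic t = {f. convex_on {0..} f \<and> (\<forall>x\<ge>0. 0 \<le> f x) \<and> mono_on {t..} f}"

text \<open>
  The probabilities of the values \<open>0\<close>, \<open>p\<close>, \<open>1\<close>, in this order.  They are meant for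
  \<open>0 < p < 1\<close>, \<open>0 < \<sigma>\<close> and \<open>\<sigma>\<^sup>2 \<le> p (1 - p)\<close>; then the first two cases exclude each other, so their
  order does not matter.
\<close>

definition xi_probs :: "real \<Rightarrow> real \<Rightarrow> real \<times> real \<times> real" where
  "xi_probs p \<sigma> =
    (if \<sigma> > 1 - p then
       ((\<sigma>\<^sup>2 - p * \<sigma>\<^sup>2) / (p * ((1 - p)\<^sup>2 + \<sigma>\<^sup>2)),
        ((1 - p) * ((1 - p) * p - \<sigma>\<^sup>2)) / (p * ((1 - p)\<^sup>2 + \<sigma>\<^sup>2)),
        \<sigma>\<^sup>2 / ((1 - p)\<^sup>2 + \<sigma>\<^sup>2))
     else if \<sigma> > p then
       (\<sigma>\<^sup>2 / (p\<^sup>2 + \<sigma>\<^sup>2),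
        (p * ((1 - p) * p - \<sigma>\<^sup>2)) / ((1 - p) * (p\<^sup>2 + \<sigma>\<^sup>2)),
        (p * \<sigma>\<^sup>2) / ((1 - p) * (p\<^sup>2 + \<sigma>\<^sup>2)))
     else
       (\<sigma> / (2 * p),
        1 - \<sigma> / (2 * (1 - p) * p),
        \<sigma> / (2 - 2 * p)))"

text \<open>
  The values lie in \<open>{0, p, 1}\<close> everywhere and not just almost surely: an \<open>f \<in> F_ic t\<close> may be
  non-measurable on the negative half-line, and \<open>f\<close> composed with a sum of such variables has to be
  integrable.
\<close>

definition xi_distributed :: "'a measure \<Rightarrow> ('a \<Rightarrow> real) \<Rightarrow> real \<Rightarrow> real \<Rightarrow> bool" where
  "xi_distributed N Y p \<sigma> \<longleftrightarrow>
     Y \<in> borel_measurable N \<and> (\<forall>\<omega>\<in>space N. Y \<omega> \<in> {0, p, 1}) \<and>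
     (measure N {\<omega> \<in> space N. Y \<omega> = 0},
      measure N {\<omega> \<in> space N. Y \<omega> = p},
      measure N {\<omega> \<in> space N. Y \<omega> = 1}) = xi_probs p \<sigma>"

end

theory Submission
  imports Defs
begin

text \<open>
  Markov's inequality for a hinge \<open>x \<mapsto> max 0 (x - \<epsilon>) / (t - \<epsilon>)\<close> bounds the tail
  \<open>P(S \<ge> t)\<close> by \<open>E max 0 (S - \<epsilon>) / (t - \<epsilon>)\<close>, so everything reduces to the function
  \<open>\<epsilon> \<mapsto> E max 0 (S - \<epsilon>)\<close>, called the stop-loss transform of \<open>S\<close> in actuarial mathematics.
  Two independent facts make up the proof.

  First, among all variables in \<open>[0,1]\<close> with mean \<open>p\<close> and variance \<open>\<sigma>\<^sup>2\<close>, the variable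
  \<open>\<xi>\<^bsub>p,\<sigma>\<^esub>\<close> is the largest in convex order (\<open>convex_expectation_le_xi\<close>). A convex function
  lies below its two chords over \<open>[0,p]\<close> and \<open>[p,1]\<close>, and the chords are exact on the three
  atoms of \<open>\<xi>\<close>. Up to an affine function, which only sees the mean, the chords are a nonnegative
  multiple of \<open>max 0 (x - p)\<close>. So the single inequality \<open>E max 0 (X - p) \<le> E max 0 (\<xi> - p)\<close>
  suffices, and it follows from a quadratic that majorizes \<open>max 0 (x - p)\<close> on \<open>[0,1]\<close>, because
  the expectation of a quadratic is determined by \<open>p\<close> and \<open>\<sigma>\<close>; the three cases in the
  distribution of \<open>\<xi>\<close> correspond to three choices of the quadratic (\<open>quadratic_majorant\<close>).
  Conditioning on one summand at a time carries the comparison of stop-loss transforms over to sums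
  of independent variables (\<open>stop_loss_sum_le\<close>). This gives the tail bound for every hinge with
  \<open>\<epsilon> < t\<close>.

  Second, hinges are optimal. Write \<open>Z\<close> for the sum of the \<open>\<xi>\<^sub>i\<close>. A convex \<open>f \<ge> 0\<close> lies above
  its supporting line at \<open>t\<close>. If that line vanishes at some \<open>\<epsilon> \<in> (0,t)\<close>, then \<open>f / f t\<close>
  lies above the hinge at \<open>\<epsilon>\<close>; otherwise the line is so flat that \<open>E Z < t\<close> makes the hinge
  at \<open>0\<close> at least as good (\<open>normalized_stop_loss_le_convex\<close>). Finally the best hinge exists: its
  value is continuous in \<open>\<epsilon> \<in> [0,t)\<close> and tends to infinity at \<open>t\<close>, because \<open>Z = n > t\<close> has
  positive probability (\<open>normalized_stop_loss_attains_min\<close>, \<open>prob_sum_xi_max_pos\<close>).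
\<close>

section \<open>Extremality of the three-point variable\<close>

definition stop_loss :: "'a measure \<Rightarrow> ('a \<Rightarrow> real) \<Rightarrow> real \<Rightarrow> real" where
  "stop_loss M S c = integral\<^sup>L M (\<lambda>\<omega>. max 0 (S \<omega> - c))"

text \<open>
  Together with \<open>a + b + c = 1\<close> this says that \<open>\<xi>\<close> has mean \<open>p\<close>.
\<close>
lemma xi_probs_balance:
  assumes "0 < p" "p < 1" "xi_probs p \<sigma> = (a, b, c)"
  shows "p * a = (1 - p) * c"
proof -
  have D: "(1 - p)\<^sup>2 + \<sigma>\<^sup>2 \<noteq> 0" "p\<^sup>2 + \<sigma>\<^sup>2 \<noteq> 0"
    using assms by (auto simp: sum_power2_eq_zero_iff)
  consider "\<sigma> > 1 - p" | "\<not> \<sigma> > 1 - p" "\<sigma> > p" | "\<not> \<sigma> > 1 - p" "\<not> \<sigma> > p" by blast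
  then show ?thesis
  proof cases
    case 1
    then have "a = (\<sigma>\<^sup>2 - p * \<sigma>\<^sup>2) / (p * ((1 - p)\<^sup>2 + \<sigma>\<^sup>2))" "c = \<sigma>\<^sup>2 / ((1 - p)\<^sup>2 + \<sigma>\<^sup>2)"
      using assms(3) by (auto simp: xi_probs_def)
    then show ?thesis using assms D by (simp add: left_diff_distrib)
  next
    case 2
    then have "a = \<sigma>\<^sup>2 / (p\<^sup>2 + \<sigma>\<^sup>2)" "c = (p * \<sigma>\<^sup>2) / ((1 - p) * (p\<^sup>2 + \<sigma>\<^sup>2))"
      using assms(3) by (auto simp: xi_probs_def)
    then show ?thesis using assms D by simp
  next
    case 3
    then have "a = \<sigma> / (2 * p)" "c = \<sigma> / (2 - 2 * p)"
      using assms(3) by (auto simp: xi_probs_def)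
    then have "a * (2 * p) = \<sigma>" "c * (2 - 2 * p) = \<sigma>" using assms(1,2) by simp_all
    then show ?thesis by (simp add: algebra_simps)
  qed
qed

lemma xi_probs_one_pos:
  assumes "0 < p" "p < 1" "0 < \<sigma>" "xi_probs p \<sigma> = (a, b, c)"
  shows "0 < c"
proof -
  have D: "(1 - p)\<^sup>2 + \<sigma>\<^sup>2 > 0" "p\<^sup>2 + \<sigma>\<^sup>2 > 0" using assms by (auto intro: add_pos_pos)
  from assms(4)[symmetric] D assms(1-3) show ?thesis by (auto simp: xi_probs_def split: if_splits)
qed

text \<open>
  Some two-point variable with mean \<open>p\<close> and variance \<open>\<sigma>\<^sup>2\<close> maximizes \<open>E max 0 (X - p)\<close>, and the
  quadratic is chosen to agree with \<open>max 0 (x - p)\<close> at its two atoms. For \<open>\<sigma> \<le> min p (1 - p)\<close>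
  these are \<open>p \<plusminus> \<sigma>\<close> with equal weights. For \<open>\<sigma> > 1 - p\<close> the upper point \<open>p + \<sigma>\<close> would leave the interval, so the atoms
  are \<open>1\<close> and \<open>p - s\<close>, where the variance forces \<open>s (1 - p) = \<sigma>\<^sup>2\<close>. The case \<open>\<sigma> > p\<close> is
  the mirror image: there \<open>max 0 (p - x) = max 0 (x - p) - (x - p)\<close> is majorized, which accounts
  for the linear term. The right-hand side of the second claim is \<open>E max 0 (\<xi> - p)\<close>.
\<close>
lemma quadratic_majorant:
  assumes "0 < p" "p < 1" "0 < \<sigma>" "xi_probs p \<sigma> = (a, b, c)"
  obtains \<beta> \<gamma> s :: real where
    "\<forall>x\<in>{0..1}. max 0 (x - p) \<le> \<beta> * (x - p) + \<gamma> * (x - p + s)\<^sup>2"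
    "\<gamma> * (\<sigma>\<^sup>2 + s\<^sup>2) = (1 - p) * c"
proof -
  define q where "q = 1 - p"
  have q: "0 < q" using assms by (simp add: q_def)
  consider "\<sigma> > q" | "\<not> \<sigma> > q" "\<sigma> > p" | "\<not> \<sigma> > q" "\<not> \<sigma> > p" by blast
  then show ?thesis
  proof cases
    case 1
    then have c: "c = \<sigma>\<^sup>2 / (q\<^sup>2 + \<sigma>\<^sup>2)" using assms(4) by (auto simp: xi_probs_def q_def)
    define s where "s = \<sigma>\<^sup>2 / q"
    have s: "s * q = \<sigma>\<^sup>2" "s > 0" using q assms(3) by (auto simp: s_def)
    have "q * q < s * q" unfolding s power2_eq_square using 1 q by (intro mult_strict_mono) auto
    then have sq: "q < s" using q by simp
    show ?thesis
    proof (rule that[of 0 "q / (q + s)\<^sup>2" s])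
      show "\<forall>x\<in>{0..1}. max 0 (x - p) \<le> 0 * (x - p) + q / (q + s)\<^sup>2 * (x - p + s)\<^sup>2"
      proof
        fix x :: real assume "x \<in> {0..1}"
        then have x: "0 \<le> x" "x \<le> 1" by auto
        define y where "y = x - p"
        have y: "y \<le> q" using x by (simp add: y_def q_def)
        \<comment> \<open>The gap \<open>q (y + s)\<^sup>2 - y (q + s)\<^sup>2\<close> factors as \<open>(q - y) (s\<^sup>2 - q y)\<close>.\<close>
        have "q * y \<le> q * q" using q y by (intro mult_left_mono) auto
        then have "q * y \<le> s * s" using sq q mult_mono[of q s q s] by linarith
        then have "(q - y) * (s * s - q * y) \<ge> 0" using y by (intro mult_nonneg_nonneg) auto
        then have "y * (q + s)\<^sup>2 \<le> q * (y + s)\<^sup>2" by (simp add: power2_eq_square algebra_simps)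
        then have "y \<le> q / (q + s)\<^sup>2 * (y + s)\<^sup>2" using q s by (simp add: field_simps)
        then show "max 0 (x - p) \<le> 0 * (x - p) + q / (q + s)\<^sup>2 * (x - p + s)\<^sup>2"
          using q by (simp add: y_def)
      qed
    next
      have "q + s \<noteq> 0" using q s by simp
      have "q / (q + s)\<^sup>2 * (\<sigma>\<^sup>2 + s\<^sup>2) = q / (q + s)\<^sup>2 * (s * (q + s))"
        using s by (simp add: power2_eq_square algebra_simps)
      also have "\<dots> = q * s / (q + s)" using \<open>q + s \<noteq> 0\<close> by (simp add: power2_eq_square)
      also have "\<dots> = q * c"
      proof -
        have "q\<^sup>2 + s * q = q * (q + s)" by (simp add: power2_eq_square algebra_simps)
        then show ?thesis unfolding c s(1)[symmetric] using q by simp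
      qed
      finally show "q / (q + s)\<^sup>2 * (\<sigma>\<^sup>2 + s\<^sup>2) = (1 - p) * c" by (simp add: q_def)
    qed
  next
    case 2
    then have c: "c = (p * \<sigma>\<^sup>2) / (q * (p\<^sup>2 + \<sigma>\<^sup>2))" using assms(4) by (auto simp: xi_probs_def q_def)
    define s where "s = \<sigma>\<^sup>2 / p"
    have s: "s * p = \<sigma>\<^sup>2" "s > 0" using assms by (auto simp: s_def)
    have "p * p < s * p" unfolding s power2_eq_square using 2 assms by (intro mult_strict_mono) auto
    then have sp: "p < s" using assms by simp
    show ?thesis
    proof (rule that[of 1 "p / (p + s)\<^sup>2" "- s"])
      show "\<forall>x\<in>{0..1}. max 0 (x - p) \<le> 1 * (x - p) + p / (p + s)\<^sup>2 * (x - p + - s)\<^sup>2"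
      proof
        fix x :: real assume "x \<in> {0..1}"
        then have x: "0 \<le> x" "x \<le> 1" by auto
        define y where "y = p - x"
        have y: "y \<le> p" using x by (simp add: y_def)
        have "p * y \<le> p * p" using assms y by (intro mult_left_mono) auto
        then have "p * y \<le> s * s" using sp assms mult_mono[of p s p s] by linarith
        then have "(p - y) * (s * s - p * y) \<ge> 0" using y by (intro mult_nonneg_nonneg) auto
        then have "y * (p + s)\<^sup>2 \<le> p * (y + s)\<^sup>2" by (simp add: power2_eq_square algebra_simps)
        then have "y \<le> p / (p + s)\<^sup>2 * (y + s)\<^sup>2" using assms s by (simp add: field_simps)
        moreover have "(x - p + - s)\<^sup>2 = (y + s)\<^sup>2" by (simp add: y_def power2_eq_square algebra_simps)
        moreover have "0 \<le> p / (p + s)\<^sup>2 * (y + s)\<^sup>2" using assms by simp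
        ultimately show "max 0 (x - p) \<le> 1 * (x - p) + p / (p + s)\<^sup>2 * (x - p + - s)\<^sup>2"
          using y_def by simp
      qed
    next
      have "p + s \<noteq> 0" using assms s by simp
      have "p / (p + s)\<^sup>2 * (\<sigma>\<^sup>2 + (- s)\<^sup>2) = p / (p + s)\<^sup>2 * (s * (p + s))"
        using s by (simp add: power2_eq_square algebra_simps)
      also have "\<dots> = p * s / (p + s)" using \<open>p + s \<noteq> 0\<close> by (simp add: power2_eq_square)
      also have "\<dots> = q * c"
      proof -
        have "p\<^sup>2 + s * p = p * (p + s)" by (simp add: power2_eq_square algebra_simps)
        then show ?thesis unfolding c s(1)[symmetric] using q assms by simp
      qed
      finally show "p / (p + s)\<^sup>2 * (\<sigma>\<^sup>2 + (- s)\<^sup>2) = (1 - p) * c" by (simp add: q_def)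
    qed
  next
    case 3
    then have c: "c = \<sigma> / (2 - 2 * p)" using assms(4) by (auto simp: xi_probs_def q_def)
    show ?thesis
    proof (rule that[of 0 "1 / (4 * \<sigma>)" \<sigma>])
      show "\<forall>x\<in>{0..1}. max 0 (x - p) \<le> 0 * (x - p) + 1 / (4 * \<sigma>) * (x - p + \<sigma>)\<^sup>2"
      proof
        fix x :: real
        have "4 * \<sigma> * (x - p) \<le> (x - p + \<sigma>)\<^sup>2"
          using zero_le_power2[of "x - p - \<sigma>"] by (simp add: power2_eq_square algebra_simps)
        then have "x - p \<le> 1 / (4 * \<sigma>) * (x - p + \<sigma>)\<^sup>2" using assms by (simp add: field_simps)
        then show "max 0 (x - p) \<le> 0 * (x - p) + 1 / (4 * \<sigma>) * (x - p + \<sigma>)\<^sup>2"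
          using assms by simp
      qed
    next
      show "1 / (4 * \<sigma>) * (\<sigma>\<^sup>2 + \<sigma>\<^sup>2) = (1 - p) * c"
        using assms c by (simp add: field_simps power2_eq_square)
    qed
  qed
qed

lemma (in prob_space) integrable_continuous_bounded:
  fixes g :: "real \<Rightarrow> real"
  assumes [measurable]: "X \<in> borel_measurable M" and bd: "AE \<omega> in M. a \<le> X \<omega> \<and> X \<omega> \<le> b"
    and g: "continuous_on UNIV g"
  shows "integrable M (\<lambda>\<omega>. g (X \<omega>))"
proof -
  have [measurable]: "g \<in> borel_measurable borel" using g by (rule borel_measurable_continuous_onI)
  have "compact (g ` {a..b})"
    by (rule compact_continuous_image) (auto intro: continuous_on_subset[OF g])
  then obtain B where B: "\<And>y. y \<in> g ` {a..b} \<Longrightarrow> norm y \<le> B"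
    using compact_imp_bounded[of "g ` {a..b}"] unfolding bounded_iff by blast
  show ?thesis
    by (rule integrable_const_bound[where B = B]) (use bd B in \<open>auto elim: eventually_mono\<close>)
qed

text \<open>
  The mean of the majorizing quadratic depends on \<open>X\<close> only through \<open>p\<close> and \<open>\<sigma>\<close>, and the linear
  term has mean zero.
\<close>
lemma (in prob_space) stop_loss_mean_le:
  assumes X: "X \<in> class_B M p (\<sigma>\<^sup>2)" and p: "0 < p" "p < 1" "0 < \<sigma>"
    and abc: "xi_probs p \<sigma> = (a, b, c)"
  shows "stop_loss M X p \<le> (1 - p) * c"
proof -
  have [measurable]: "X \<in> borel_measurable M" and bd: "AE \<omega> in M. 0 \<le> X \<omega> \<and> X \<omega> \<le> 1"
    and mean: "expectation X = p" and var: "variance X = \<sigma>\<^sup>2"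
    using X by (auto simp: class_B_def)
  obtain \<beta> \<gamma> s where maj: "\<forall>x\<in>{0..1}. max 0 (x - p) \<le> \<beta> * (x - p) + \<gamma> * (x - p + s)\<^sup>2"
    and val: "\<gamma> * (\<sigma>\<^sup>2 + s\<^sup>2) = (1 - p) * c"
    using quadratic_majorant[OF p abc] by blast
  note int = integrable_continuous_bounded[OF \<open>X \<in> borel_measurable M\<close> bd]
  have iX: "integrable M X" using int[of "\<lambda>x. x"] by (simp add: continuous_on_id)
  have iX2: "integrable M (\<lambda>\<omega>. (X \<omega> - p)\<^sup>2)"
    by (rule int) (intro continuous_intros)
  have "stop_loss M X p \<le> expectation (\<lambda>\<omega>. \<beta> * (X \<omega> - p) + \<gamma> * (X \<omega> - p + s)\<^sup>2)"
    unfolding stop_loss_def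
  proof (rule integral_mono_AE)
    show "AE \<omega> in M. max 0 (X \<omega> - p) \<le> \<beta> * (X \<omega> - p) + \<gamma> * (X \<omega> - p + s)\<^sup>2"
      using bd by (rule eventually_mono) (use maj in simp)
  qed (rule int, intro continuous_intros)+
  also have "\<dots> = expectation (\<lambda>\<omega>. \<gamma> * (X \<omega> - p)\<^sup>2 + (\<beta> + 2 * \<gamma> * s) * (X \<omega> - p) + \<gamma> * s\<^sup>2)"
    by (intro Bochner_Integration.integral_cong) (auto simp: power2_eq_square algebra_simps)
  also have "\<dots> = \<gamma> * (\<sigma>\<^sup>2 + s\<^sup>2)"
    using iX iX2 mean var by (simp add: prob_space algebra_simps)
  finally show ?thesis using val by simp
qed

lemma (in prob_space) xi_expectation:
  assumes Y: "xi_distributed M Y p \<sigma>" and p: "0 < p" "p < 1"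
    and abc: "xi_probs p \<sigma> = (a, b, c)"
  shows "expectation (\<lambda>\<omega>. g (Y \<omega>)) = a * g 0 + b * g p + c * g 1" (is ?E)
    and "a + b + c = 1" (is ?one)
proof -
  have [measurable]: "Y \<in> borel_measurable M" and val: "\<forall>\<omega>\<in>space M. Y \<omega> \<in> {0, p, 1}"
    and pr: "prob {\<omega> \<in> space M. Y \<omega> = 0} = a" "prob {\<omega> \<in> space M. Y \<omega> = p} = b"
      "prob {\<omega> \<in> space M. Y \<omega> = 1} = c"
    using Y abc by (auto simp: xi_distributed_def)
  have *: "expectation (\<lambda>\<omega>. h (Y \<omega>)) = a * h 0 + b * h p + c * h 1" for h :: "real \<Rightarrow> real"
  proof -
    have "expectation (\<lambda>\<omega>. h (Y \<omega>)) = expectation (\<lambda>\<omega>. 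
        indicator {\<omega> \<in> space M. Y \<omega> = 0} \<omega> * h 0 + indicator {\<omega> \<in> space M. Y \<omega> = p} \<omega> * h p +
        indicator {\<omega> \<in> space M. Y \<omega> = 1} \<omega> * h 1)"
      using val p by (intro Bochner_Integration.integral_cong) (auto simp: indicator_def)
    also have "\<dots> = a * h 0 + b * h p + c * h 1"
      by (simp add: pr emeasure_eq_measure)
    finally show ?thesis .
  qed
  show ?E by (rule *)
  show ?one using *[of "\<lambda>_. 1"] by (simp add: prob_space)
qed

text \<open>
  The right-hand side is the piecewise linear interpolation of \<open>g\<close> at \<open>0\<close>, \<open>p\<close> and \<open>1\<close>, written
  so that its kink at \<open>p\<close> is explicit.
\<close>
lemma convex_on_le_two_chords:
  fixes g :: "real \<Rightarrow> real"
  assumes g: "convex_on {0..1} g" and p: "0 < p" "p < 1" and x: "0 \<le> x" "x \<le> 1"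
  defines "s \<equiv> (g p - g 0) / p" and "s' \<equiv> (g 1 - g p) / (1 - p)"
  shows "g x \<le> g p + s * (x - p) + (s' - s) * max 0 (x - p)" and "s \<le> s'"
proof -
  have A: "g p \<le> (1 - p) * g 0 + p * g 1"
    using convex_onD[OF g, of p 0 1] p by simp
  show "s \<le> s'"
  proof -
    have "(g p - g 0) * (1 - p) \<le> (g 1 - g p) * p" using A by (simp add: algebra_simps)
    then show ?thesis unfolding s_def s'_def using p by (simp add: pos_divide_le_eq pos_le_divide_eq mult.commute)
  qed
  show "g x \<le> g p + s * (x - p) + (s' - s) * max 0 (x - p)"
  proof (cases "x \<le> p")
    case True
    have "g x \<le> (1 - x / p) * g 0 + x / p * g p"
      using convex_onD[OF g, of "x / p" 0 p] p x True by simp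
    also have "\<dots> = g p + s * (x - p)" using p by (simp add: s_def field_simps)
    finally show ?thesis using True by (simp add: max_def)
  next
    case False
    define u where "u = (x - p) / (1 - p)"
    have up: "u * (1 - p) = x - p" using p by (simp add: u_def)
    then have ux: "(1 - u) * p + u = x" by (simp add: algebra_simps)
    have u: "0 \<le> u" "u \<le> 1" using False p x by (auto simp: u_def divide_simps)
    have "g x \<le> (1 - u) * g p + u * g 1"
      using convex_onD[OF g, of u p 1] p u ux by simp
    also have "\<dots> = g p + u * (g 1 - g p)" by (simp add: algebra_simps)
    also have "g 1 - g p = (1 - p) * s'" using p by (simp add: s'_def)
    also have "g p + u * ((1 - p) * s') = g p + s' * (x - p)" unfolding up[symmetric] by simp
    finally show ?thesis using False by (simp add: algebra_simps)
  qed
qed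

text \<open>
  Replacing \<open>g\<close> by its two chords increases the left-hand side and does not change the right-hand
  side. For the chords only the coefficient \<open>s' - s \<ge> 0\<close> of \<open>max 0 (x - p)\<close> matters.
\<close>
lemma convex_expectation_le_xi:
  fixes g :: "real \<Rightarrow> real"
  assumes "prob_space M" "prob_space N"
    and X: "X \<in> class_B M p (\<sigma>\<^sup>2)" and Y: "xi_distributed N Y p \<sigma>"
    and p: "0 < p" "p < 1" "0 < \<sigma>"
    and g: "convex_on {0..1} g" "integrable M (\<lambda>\<omega>. g (X \<omega>))"
  shows "integral\<^sup>L M (\<lambda>\<omega>. g (X \<omega>)) \<le> integral\<^sup>L N (\<lambda>\<omega>. g (Y \<omega>))"
proof -
  interpret M: prob_space M by fact
  interpret N: prob_space N by fact
  obtain a b c where abc: "xi_probs p \<sigma> = (a, b, c)" by (cases "xi_probs p \<sigma>")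
  have [measurable]: "X \<in> borel_measurable M" and bd: "AE \<omega> in M. 0 \<le> X \<omega> \<and> X \<omega> \<le> 1"
    and mean: "integral\<^sup>L M X = p"
    using X by (auto simp: class_B_def)
  note int = M.integrable_continuous_bounded[OF \<open>X \<in> borel_measurable M\<close> bd]
  have iX: "integrable M X" using int[of "\<lambda>x. x"] by (simp add: continuous_on_id)
  have im: "integrable M (\<lambda>\<omega>. max 0 (X \<omega> - p))" by (rule int) (intro continuous_intros)
  define s where "s = (g p - g 0) / p"
  define s' where "s' = (g 1 - g p) / (1 - p)"
  have "s \<le> s'" using convex_on_le_two_chords(2)[OF g(1) p(1,2), of 0] by (simp add: s_def s'_def)
  have "integral\<^sup>L M (\<lambda>\<omega>. g (X \<omega>)) \<le>
      integral\<^sup>L M (\<lambda>\<omega>. g p + s * (X \<omega> - p) + (s' - s) * max 0 (X \<omega> - p))"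
  proof (rule integral_mono_AE)
    show "AE \<omega> in M. g (X \<omega>) \<le> g p + s * (X \<omega> - p) + (s' - s) * max 0 (X \<omega> - p)"
      using bd by (rule eventually_mono)
        (use convex_on_le_two_chords(1)[OF g(1) p(1,2)] in \<open>simp add: s_def s'_def\<close>)
  qed (use iX im g in auto)
  also have "\<dots> = g p + (s' - s) * stop_loss M X p"
    using iX im by (simp add: M.prob_space mean stop_loss_def)
  also have "\<dots> \<le> g p + (s' - s) * ((1 - p) * c)"
    using M.stop_loss_mean_le[OF X p abc] \<open>s \<le> s'\<close> by (intro add_left_mono mult_left_mono) auto
  also have "\<dots> = g p + (g 1 - g p) * c - s * ((1 - p) * c)"
  proof -
    have "(s' - s) * ((1 - p) * c) = s' * (1 - p) * c - s * ((1 - p) * c)" by (simp add: left_diff_distrib)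
    then show ?thesis using p by (simp add: s'_def)
  qed
  also have "\<dots> = g p + (g 1 - g p) * c - (g p - g 0) * a"
    using p unfolding xi_probs_balance[OF p(1,2) abc, symmetric] by (simp add: s_def)
  also have "\<dots> = a * g 0 + (1 - a - c) * g p + c * g 1" by (simp add: algebra_simps)
  also have "1 - a - c = b" using N.xi_expectation(2)[OF Y p(1,2) abc] by simp
  also have "a * g 0 + b * g p + c * g 1 = integral\<^sup>L N (\<lambda>\<omega>. g (Y \<omega>))"
    using N.xi_expectation(1)[OF Y p(1,2) abc] by simp
  finally show ?thesis .
qed

section \<open>Stop-loss transforms of independent sums\<close>

lemma (in prob_space) stop_loss_integrable:
  fixes S :: "'a \<Rightarrow> real"
  shows "integrable M S \<Longrightarrow> integrable M (\<lambda>\<omega>. max 0 (S \<omega> - c))"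
  by (intro Bochner_Integration.integrable_max) auto

lemma (in prob_space) convex_on_stop_loss:
  assumes S: "integrable M S"
  shows "convex_on UNIV (stop_loss M S)"
proof (rule convex_onI)
  fix u x y :: real assume u: "0 < u" "u < 1"
  note int = stop_loss_integrable[OF S]
  have "stop_loss M S ((1 - u) *\<^sub>R x + u *\<^sub>R y) \<le>
      expectation (\<lambda>\<omega>. (1 - u) * max 0 (S \<omega> - x) + u * max 0 (S \<omega> - y))"
    unfolding stop_loss_def
  proof (rule integral_mono)
    fix \<omega>
    have "S \<omega> - ((1 - u) * x + u * y) = (1 - u) * (S \<omega> - x) + u * (S \<omega> - y)"
      by (simp add: algebra_simps)
    moreover have "(1 - u) * (S \<omega> - x) \<le> (1 - u) * max 0 (S \<omega> - x)"
      "u * (S \<omega> - y) \<le> u * max 0 (S \<omega> - y)"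
      "0 \<le> (1 - u) * max 0 (S \<omega> - x)" "0 \<le> u * max 0 (S \<omega> - y)"
      using u by (auto intro!: mult_left_mono mult_nonneg_nonneg)
    ultimately show "max 0 (S \<omega> - ((1 - u) *\<^sub>R x + u *\<^sub>R y)) \<le>
        (1 - u) * max 0 (S \<omega> - x) + u * max 0 (S \<omega> - y)"
      by simp
  qed (use int in auto)
  also have "\<dots> = (1 - u) * stop_loss M S x + u * stop_loss M S y"
    using int by (simp add: stop_loss_def)
  finally show "stop_loss M S ((1 - u) *\<^sub>R x + u *\<^sub>R y) \<le> (1 - u) * stop_loss M S x + u * stop_loss M S y" .
qed simp

lemma (in prob_space) continuous_on_stop_loss:
  "integrable M S \<Longrightarrow> continuous_on UNIV (stop_loss M S)"
  using convex_on_stop_loss by (rule convex_on_continuous[OF open_UNIV])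

text \<open>
  Independence turns the joint law into a product measure, so this is Fubini's theorem read on the
  original probability space.
\<close>
lemma (in prob_space) indep_var_expectation_iterated:
  fixes F :: "real \<Rightarrow> real \<Rightarrow> real"
  assumes ind: "indep_var borel X borel Y"
    and [measurable]: "case_prod F \<in> borel_measurable (borel \<Otimes>\<^sub>M borel)"
    and int: "integrable M (\<lambda>\<omega>. F (X \<omega>) (Y \<omega>))"
  shows "expectation (\<lambda>\<omega>. F (X \<omega>) (Y \<omega>)) = expectation (\<lambda>\<omega>. expectation (\<lambda>\<omega>'. F (X \<omega>) (Y \<omega>')))"
proof -
  have [measurable]: "X \<in> borel_measurable M" "Y \<in> borel_measurable M"
    using indep_var_rv1[OF ind] indep_var_rv2[OF ind] by auto
  have joint: "distr M borel X \<Otimes>\<^sub>M distr M borel Y = distr M (borel \<Otimes>\<^sub>M borel) (\<lambda>x. (X x, Y x))"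
    using ind by (simp add: indep_var_distribution_eq)
  interpret X: prob_space "distr M borel X" by (rule prob_space_distr) simp
  interpret Y: prob_space "distr M borel Y" by (rule prob_space_distr) simp
  interpret XY: pair_prob_space "distr M borel X" "distr M borel Y" ..
  have "integrable (distr M borel X \<Otimes>\<^sub>M distr M borel Y) (case_prod F)"
    unfolding joint using int by (subst integrable_distr_eq) auto
  from XY.integral_fst'[OF this]
  have "(\<integral>x. (\<integral>y. F x y \<partial>distr M borel Y) \<partial>distr M borel X) = expectation (\<lambda>\<omega>. F (X \<omega>) (Y \<omega>))"
    unfolding joint by (subst (asm) (3) integral_distr) auto
  moreover have "(\<integral>y. F x y \<partial>distr M borel Y) = expectation (\<lambda>\<omega>'. F x (Y \<omega>'))" for x
    by (subst integral_distr) auto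
  ultimately have "(\<integral>x. expectation (\<lambda>\<omega>'. F x (Y \<omega>')) \<partial>distr M borel X) = expectation (\<lambda>\<omega>. F (X \<omega>) (Y \<omega>))"
    by simp
  then show ?thesis by (subst (asm) integral_distr) auto
qed

lemma (in prob_space) stop_loss_indep_sum:
  assumes ind: "indep_var borel X borel S" and "integrable M X" "integrable M S"
  shows "stop_loss M (\<lambda>\<omega>. X \<omega> + S \<omega>) c = expectation (\<lambda>\<omega>. stop_loss M S (c - X \<omega>))"
  unfolding stop_loss_def
  using indep_var_expectation_iterated[OF ind, of "\<lambda>x s. max 0 (x + s - c)"] assms(2,3)
  by (simp add: algebra_simps)

lemma convex_on_reflect:
  fixes h :: "real \<Rightarrow> real"
  assumes "convex_on UNIV h" and "convex A"
  shows "convex_on A (\<lambda>x. h (c - x))"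
proof (rule convex_onI)
  fix u x y :: real assume u: "0 < u" "u < 1"
  have "c - ((1 - u) *\<^sub>R x + u *\<^sub>R y) = (1 - u) *\<^sub>R (c - x) + u *\<^sub>R (c - y)"
    by (simp add: algebra_simps)
  then show "h (c - ((1 - u) *\<^sub>R x + u *\<^sub>R y)) \<le> (1 - u) * h (c - x) + u * h (c - y)"
    using convex_onD[OF assms(1), of u "c - x" "c - y"] u by simp
qed fact

lemma xi_distributed_bounds:
  assumes "xi_distributed N Y p \<sigma>" "0 < p" "p < 1"
  shows "AE \<omega> in N. 0 \<le> Y \<omega> \<and> Y \<omega> \<le> 1"
  using assms by (intro AE_I2) (force simp: xi_distributed_def)

text \<open>
  One summand is exchanged at a time. Conditionally on \<open>X j\<close>, the induction hypothesis replaces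
  the remaining sum. The resulting function of \<open>X j\<close> is a reflected stop-loss transform, hence
  convex, so the extremality of \<open>\<xi> j\<close> replaces \<open>X j\<close>. The two families live on different probability
  spaces, and this order of exchange never needs a joint one.
\<close>
lemma stop_loss_sum_le:
  assumes "prob_space M" "prob_space N" and "finite I"
    and "prob_space.indep_vars M (\<lambda>_. borel) X I" "prob_space.indep_vars N (\<lambda>_. borel) \<xi> I"
    and "\<And>i. i \<in> I \<Longrightarrow> X i \<in> class_B M (p i) ((\<sigma> i)\<^sup>2)"
    and "\<And>i. i \<in> I \<Longrightarrow> xi_distributed N (\<xi> i) (p i) (\<sigma> i)"
    and "\<And>i. i \<in> I \<Longrightarrow> 0 < p i \<and> p i < 1" "\<And>i. i \<in> I \<Longrightarrow> 0 < \<sigma> i"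
  shows "stop_loss M (\<lambda>\<omega>. \<Sum>i\<in>I. X i \<omega>) c \<le> stop_loss N (\<lambda>\<omega>. \<Sum>i\<in>I. \<xi> i \<omega>) c"
  using assms(3-)
proof (induction I arbitrary: c rule: finite_induct)
  case empty
  interpret M: prob_space M by fact
  interpret N: prob_space N by fact
  show ?case by (simp add: stop_loss_def M.prob_space N.prob_space)
next
  case (insert j I)
  interpret M: prob_space M by fact
  interpret N: prob_space N by fact
  have p: "0 < p i" "p i < 1" "0 < \<sigma> i" if "i \<in> insert j I" for i
    using insert.prems(5,6) that by auto
  have Xm: "X i \<in> borel_measurable M" and Xb: "AE \<omega> in M. 0 \<le> X i \<omega> \<and> X i \<omega> \<le> 1" if "i \<in> insert j I" for i
    using insert.prems(3)[OF that] by (auto simp: class_B_def)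
  have Ym: "\<xi> i \<in> borel_measurable N" and Yb: "AE \<omega> in N. 0 \<le> \<xi> i \<omega> \<and> \<xi> i \<omega> \<le> 1" if "i \<in> insert j I" for i
    using insert.prems(4)[OF that] xi_distributed_bounds p[OF that] by (auto simp: xi_distributed_def)
  have iX: "integrable M (X i)" and iY: "integrable N (\<xi> i)" if "i \<in> insert j I" for i
    using M.integrable_continuous_bounded[OF Xm Xb continuous_on_id, OF that that]
      N.integrable_continuous_bounded[OF Ym Yb continuous_on_id, OF that that] by auto
  let ?S = "\<lambda>\<omega>. \<Sum>i\<in>I. X i \<omega>" and ?Z = "\<lambda>\<omega>. \<Sum>i\<in>I. \<xi> i \<omega>"
  have iS: "integrable M ?S" and iZ: "integrable N ?Z" using iX iY by auto
  have indX: "M.indep_var borel (X j) borel ?S"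
    using insert by (intro M.indep_vars_sum) auto
  have indY: "N.indep_var borel (\<xi> j) borel ?Z"
    using insert by (intro N.indep_vars_sum) auto
  have IH: "stop_loss M ?S d \<le> stop_loss N ?Z d" for d
  proof (rule insert.IH)
    show "M.indep_vars (\<lambda>_. borel) X I" using insert.prems(1) by (rule M.indep_vars_subset) auto
    show "N.indep_vars (\<lambda>_. borel) \<xi> I" using insert.prems(2) by (rule N.indep_vars_subset) auto
  qed (use insert.prems in auto)
  have cS: "continuous_on UNIV (\<lambda>x. stop_loss M ?S (c - x))"
    by (intro continuous_on_compose2[OF M.continuous_on_stop_loss[OF iS]] continuous_intros) auto
  have cZ: "continuous_on UNIV (\<lambda>x. stop_loss N ?Z (c - x))"
    by (intro continuous_on_compose2[OF N.continuous_on_stop_loss[OF iZ]] continuous_intros) auto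
  have int: "integrable M (\<lambda>\<omega>. stop_loss M ?S (c - X j \<omega>))" "integrable M (\<lambda>\<omega>. stop_loss N ?Z (c - X j \<omega>))"
    using M.integrable_continuous_bounded[OF Xm Xb cS] M.integrable_continuous_bounded[OF Xm Xb cZ]
    by auto
  have "stop_loss M (\<lambda>\<omega>. X j \<omega> + ?S \<omega>) c = integral\<^sup>L M (\<lambda>\<omega>. stop_loss M ?S (c - X j \<omega>))"
    using indX iX iS by (intro M.stop_loss_indep_sum) auto
  also have "\<dots> \<le> integral\<^sup>L M (\<lambda>\<omega>. stop_loss N ?Z (c - X j \<omega>))"
    using int by (rule integral_mono) (rule IH)
  also have "\<dots> \<le> integral\<^sup>L N (\<lambda>\<omega>. stop_loss N ?Z (c - \<xi> j \<omega>))"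
    using convex_expectation_le_xi[OF \<open>prob_space M\<close> \<open>prob_space N\<close> insert.prems(3,4) p,
      OF _ _ _ _ _ convex_on_reflect[OF N.convex_on_stop_loss[OF iZ]], of j] int(2)
    by auto
  also have "\<dots> = stop_loss N (\<lambda>\<omega>. \<xi> j \<omega> + ?Z \<omega>) c"
    using indY iY iZ by (intro N.stop_loss_indep_sum[symmetric]) auto
  finally show ?case using insert.hyps by simp
qed

section \<open>Optimality of hinge functions\<close>

lemma convex_on_supporting_line:
  fixes f :: "real \<Rightarrow> real"
  assumes "convex_on I f" "x \<in> interior I"
  obtains m where "\<forall>y\<in>I. f x + m * (y - x) \<le> f y"
  using convex_le_Inf_differential[OF assms] by blast

text \<open>
  Let \<open>m\<close> be the slope of a supporting line at \<open>t\<close>. A line with \<open>m t > f t\<close> vanishes at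
  \<open>\<epsilon> = t - f t / m \<in> (0,t)\<close>, and \<open>f\<close> lies above its positive part. If \<open>m t \<le> f t\<close>, the
  normalized line rises no faster than \<open>x / t\<close>, the hinge at \<open>0\<close>. It may lie below that hinge
  beyond \<open>t\<close>, so there is no pointwise comparison, but the means compare, since both agree at
  \<open>t\<close> and the mean of \<open>S\<close> lies to the left of \<open>t\<close>.
\<close>
lemma (in prob_space) normalized_stop_loss_le_convex:
  assumes S: "integrable M S" "\<And>\<omega>. \<omega> \<in> space M \<Longrightarrow> 0 \<le> S \<omega>" "expectation S < t"
    and f: "convex_on {0..} f" "\<forall>x\<ge>0. 0 \<le> f x" "0 < f t" and t: "0 < t"
    and fS: "integrable M (\<lambda>\<omega>. f (S \<omega>))"
  obtains \<epsilon> where "0 \<le> \<epsilon>" "\<epsilon> < t" "stop_loss M S \<epsilon> / (t - \<epsilon>) \<le> 1 / f t * expectation (\<lambda>\<omega>. f (S \<omega>))"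
proof -
  obtain m where m: "\<forall>y\<in>{0..}. f t + m * (y - t) \<le> f y"
    using convex_on_supporting_line[OF f(1), of t] t by auto
  show ?thesis
  proof (cases "f t < m * t")
    case True
    then have "0 < m" using f(3) t by (smt (verit) mult_nonpos_nonneg)
    define \<epsilon> where "\<epsilon> = t - f t / m"
    have \<epsilon>: "0 \<le> \<epsilon>" "\<epsilon> < t" "m * (t - \<epsilon>) = f t"
      using True \<open>0 < m\<close> f(3) by (auto simp: \<epsilon>_def field_simps)
    have "m * stop_loss M S \<epsilon> = expectation (\<lambda>\<omega>. m * max 0 (S \<omega> - \<epsilon>))"
      by (simp add: stop_loss_def)
    also have "\<dots> \<le> expectation (\<lambda>\<omega>. f (S \<omega>))"
    proof (rule integral_mono)
      fix \<omega> assume \<omega>: "\<omega> \<in> space M"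
      have "m * (S \<omega> - \<epsilon>) = f t + m * (S \<omega> - t)" using \<epsilon>(3) by (simp add: algebra_simps)
      then have "m * (S \<omega> - \<epsilon>) \<le> f (S \<omega>)" using m S(2)[OF \<omega>] by simp
      then show "m * max 0 (S \<omega> - \<epsilon>) \<le> f (S \<omega>)" using f(2) S(2)[OF \<omega>] by (simp add: max_def)
    qed (use stop_loss_integrable[OF S(1)] fS in auto)
    finally have "m * stop_loss M S \<epsilon> \<le> expectation (\<lambda>\<omega>. f (S \<omega>))" .
    then have "m * stop_loss M S \<epsilon> / f t \<le> expectation (\<lambda>\<omega>. f (S \<omega>)) / f t"
      using f(3) by (intro divide_right_mono) auto
    moreover have "m * stop_loss M S \<epsilon> / f t = stop_loss M S \<epsilon> / (t - \<epsilon>)"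
      using \<open>0 < m\<close> unfolding \<epsilon>(3)[symmetric] by simp
    ultimately have "stop_loss M S \<epsilon> / (t - \<epsilon>) \<le> 1 / f t * expectation (\<lambda>\<omega>. f (S \<omega>))"
      by simp
    with \<epsilon> that show ?thesis by blast
  next
    case False
    have "stop_loss M S 0 = expectation S"
      unfolding stop_loss_def using S(2) by (intro Bochner_Integration.integral_cong) auto
    have "(f t - m * t) * expectation S \<le> (f t - m * t) * t"
      using False S(3) by (intro mult_left_mono) auto
    then have "f t * expectation S \<le> t * (f t + m * (expectation S - t))"
      by (simp add: algebra_simps)
    also have "f t + m * (expectation S - t) = expectation (\<lambda>\<omega>. f t + m * (S \<omega> - t))"
      using S(1) by (simp add: prob_space)
    also have "\<dots> \<le> expectation (\<lambda>\<omega>. f (S \<omega>))"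
      by (rule integral_mono) (use S m fS in auto)
    finally have "f t * expectation S \<le> t * expectation (\<lambda>\<omega>. f (S \<omega>))" using t by simp
    then have "stop_loss M S 0 / (t - 0) \<le> 1 / f t * expectation (\<lambda>\<omega>. f (S \<omega>))"
      using t f(3) \<open>stop_loss M S 0 = expectation S\<close> by (simp add: field_simps)
    with t that show ?thesis by blast
  qed
qed

text \<open>
  The mass at or above \<open>u > t\<close> keeps the numerator away from zero, so the quotient blows up at
  \<open>t\<close>. Hence minimizing over a compact interval \<open>[0, t - \<eta>]\<close> suffices.
\<close>
lemma (in prob_space) normalized_stop_loss_attains_min:
  assumes S: "integrable M S" and t: "0 < t" "t < u" and pos: "0 < prob {\<omega> \<in> space M. u \<le> S \<omega>}"
  obtains \<epsilon> where "0 \<le> \<epsilon>" "\<epsilon> < t" "\<forall>\<delta>\<in>{0..<t}. stop_loss M S \<epsilon> / (t - \<epsilon>) \<le> stop_loss M S \<delta> / (t - \<delta>)"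
proof -
  define \<phi> where "\<phi> \<delta> = stop_loss M S \<delta> / (t - \<delta>)" for \<delta>
  define r where "r = prob {\<omega> \<in> space M. u \<le> S \<omega>}"
  have [measurable]: "S \<in> borel_measurable M" using S by auto
  have sl: "r * (u - t) \<le> stop_loss M S \<delta>" if "\<delta> < t" for \<delta>
  proof -
    have "r * (u - t) = expectation (\<lambda>\<omega>. indicator {\<omega> \<in> space M. u \<le> S \<omega>} \<omega> * (u - t))"
      by (simp add: r_def emeasure_eq_measure)
    also have "\<dots> \<le> stop_loss M S \<delta>"
      unfolding stop_loss_def
    proof (rule integral_mono)
      show "integrable M (\<lambda>\<omega>. indicator {\<omega> \<in> space M. u \<le> S \<omega>} \<omega> * (u - t))"
        by (rule integrable_const_bound[where B = "\<bar>u - t\<bar>"]) (auto simp: indicator_def)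
    qed (use stop_loss_integrable[OF S] that in \<open>auto simp: indicator_def\<close>)
    finally show ?thesis .
  qed
  have ru: "0 < r * (u - t)" using pos t by (simp add: r_def)
  have \<phi>0: "0 < \<phi> 0" using sl[of 0] ru t by (simp add: \<phi>_def)
  \<comment> \<open>For \<open>t - \<delta> < \<eta>\<close> the quotient is at least \<open>r (u - t) / \<eta>\<close>, which is no less than \<open>\<phi> 0\<close>.\<close>
  define \<eta> where "\<eta> = min t (r * (u - t) / \<phi> 0)"
  have \<eta>: "0 < \<eta>" "\<eta> \<le> t" "\<eta> * \<phi> 0 \<le> r * (u - t)"
  proof -
    show "0 < \<eta>" "\<eta> \<le> t" using t ru \<phi>0 by (auto simp: \<eta>_def)
    have "\<eta> \<le> r * (u - t) / \<phi> 0" by (simp add: \<eta>_def)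
    then show "\<eta> * \<phi> 0 \<le> r * (u - t)" using \<phi>0 by (simp add: pos_le_divide_eq)
  qed
  have "continuous_on {0..t - \<eta>} \<phi>"
    unfolding \<phi>_def using \<eta>(1)
    by (intro continuous_intros continuous_on_subset[OF continuous_on_stop_loss[OF S]]) auto
  then obtain \<epsilon> where \<epsilon>: "\<epsilon> \<in> {0..t - \<eta>}" "\<forall>\<delta>\<in>{0..t - \<eta>}. \<phi> \<epsilon> \<le> \<phi> \<delta>"
    using continuous_attains_inf[of "{0..t - \<eta>}" \<phi>] \<eta> by auto
  have "\<phi> \<epsilon> \<le> \<phi> \<delta>" if "\<delta> \<in> {0..<t}" for \<delta>
  proof (cases "\<delta> \<le> t - \<eta>")
    case True
    then show ?thesis using \<epsilon> that by auto
  next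
    case False
    have "\<phi> \<epsilon> \<le> \<phi> 0" using \<epsilon> \<eta> by auto
    also have "\<dots> \<le> \<phi> \<delta>"
    proof -
      have "\<phi> 0 * (t - \<delta>) \<le> \<phi> 0 * \<eta>" using \<phi>0 False by (intro mult_left_mono) auto
      also have "\<dots> \<le> stop_loss M S \<delta>" using \<eta>(3) sl[of \<delta>] that by (simp add: mult.commute)
      finally show ?thesis using that by (simp add: \<phi>_def pos_le_divide_eq)
    qed
    finally show ?thesis .
  qed
  moreover have "0 \<le> \<epsilon>" "\<epsilon> < t" using \<epsilon>(1) \<eta> by auto
  ultimately show ?thesis using that unfolding \<phi>_def by blast
qed

lemma (in prob_space) prob_ge_le_stop_loss:
  assumes S: "integrable M S" and "\<epsilon> < t"
  shows "prob {\<omega> \<in> space M. t \<le> S \<omega>} \<le> stop_loss M S \<epsilon> / (t - \<epsilon>)"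
proof -
  have [measurable]: "S \<in> borel_measurable M" using S by auto
  have "prob {\<omega> \<in> space M. t \<le> S \<omega>} \<le> prob {\<omega> \<in> space M. t - \<epsilon> \<le> max 0 (S \<omega> - \<epsilon>)}"
    by (rule finite_measure_mono) auto
  also have "\<dots> \<le> stop_loss M S \<epsilon> / (t - \<epsilon>)"
    unfolding stop_loss_def
    using assms stop_loss_integrable[OF S]
    by (intro integral_Markov_inequality_measure[where A = "{}"]) auto
  finally show ?thesis .
qed

lemma (in prob_space) prob_sum_xi_max_pos:
  assumes I: "finite I" and ind: "indep_vars (\<lambda>_. borel) \<xi> I"
    and d: "\<And>i. i \<in> I \<Longrightarrow> xi_distributed M (\<xi> i) (p i) (\<sigma> i)"
    and p: "\<And>i. i \<in> I \<Longrightarrow> 0 < p i \<and> p i < 1" "\<And>i. i \<in> I \<Longrightarrow> 0 < \<sigma> i"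
  shows "0 < prob {\<omega> \<in> space M. real (card I) \<le> (\<Sum>i\<in>I. \<xi> i \<omega>)}"
proof (cases "I = {}")
  case True
  then show ?thesis by (simp add: prob_space)
next
  case False
  have [measurable]: "\<xi> i \<in> borel_measurable M" if "i \<in> I" for i
    using d[OF that] by (simp add: xi_distributed_def)
  have "0 < prob (\<xi> i -` {1} \<inter> space M)" if i: "i \<in> I" for i
  proof -
    obtain a b c where abc: "xi_probs (p i) (\<sigma> i) = (a, b, c)" by (cases "xi_probs (p i) (\<sigma> i)")
    have "\<xi> i -` {1} \<inter> space M = {\<omega> \<in> space M. \<xi> i \<omega> = 1}" by auto
    then show ?thesis
      using xi_probs_one_pos[OF _ _ _ abc] p[OF i] d[OF i] abc by (auto simp: xi_distributed_def)
  qed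
  then have "0 < (\<Prod>i\<in>I. prob (\<xi> i -` {1} \<inter> space M))" by (rule prod_pos)
  also have "\<dots> = prob (\<Inter>i\<in>I. \<xi> i -` {1} \<inter> space M)"
    using False I ind by (intro indep_varsD_finite[symmetric]) auto
  also have "\<dots> \<le> prob {\<omega> \<in> space M. real (card I) \<le> (\<Sum>i\<in>I. \<xi> i \<omega>)}"
    using False by (intro finite_measure_mono) auto
  finally show ?thesis .
qed

text \<open>
  An arbitrary, possibly non-measurable, \<open>f\<close> is harmless when \<open>S\<close> takes only finitely many
  values, as the sums of the \<open>\<xi>\<^sub>i\<close> do.
\<close>
lemma (in prob_space) integrable_comp_finite_range:
  fixes f :: "real \<Rightarrow> real"
  assumes "S \<in> borel_measurable M" "finite (S ` space M)"
  shows "integrable M (\<lambda>\<omega>. f (S \<omega>))"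
proof -
  have "simple_function M (f \<circ> S)"
    using assms by (intro simple_function_compose simple_function_borel_measurable)
  then have meas: "(\<lambda>\<omega>. f (S \<omega>)) \<in> borel_measurable M"
    by (simp add: borel_measurable_simple_function comp_def)
  have "finite ((\<lambda>\<omega>. \<bar>f (S \<omega>)\<bar>) ` space M)"
    using finite_imageI[OF assms(2), of "\<lambda>x. \<bar>f x\<bar>"] by (simp add: image_image)
  then show ?thesis
    by (intro integrable_const_bound[where B = "Max ((\<lambda>\<omega>. \<bar>f (S \<omega>)\<bar>) ` space M)"] meas AE_I2)
       (auto intro!: Max_ge)
qed

lemma hinge_mem_F_ic:
  assumes "\<epsilon> < t"
  shows "(\<lambda>x. (1 / (t - \<epsilon>)) * max 0 (x - \<epsilon>)) \<in> F_ic t"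
proof -
  have "convex_on {0..} (\<lambda>x. (1 / (t - \<epsilon>)) * max 0 (x - \<epsilon>))"
  proof (rule convex_on_cmul)
    show "convex_on {0..} (\<lambda>x. max 0 (x - \<epsilon>))"
    proof (rule convex_onI)
      fix u x y :: real assume "0 < u" "u < 1"
      then have "(1 - u) * (x - \<epsilon>) \<le> (1 - u) * max 0 (x - \<epsilon>)" "u * (y - \<epsilon>) \<le> u * max 0 (y - \<epsilon>)"
        "0 \<le> (1 - u) * max 0 (x - \<epsilon>)" "0 \<le> u * max 0 (y - \<epsilon>)"
        by (auto intro!: mult_left_mono mult_nonneg_nonneg)
      moreover have "(1 - u) *\<^sub>R x + u *\<^sub>R y - \<epsilon> = (1 - u) * (x - \<epsilon>) + u * (y - \<epsilon>)"
        by (simp add: algebra_simps)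
      ultimately show "max 0 ((1 - u) *\<^sub>R x + u *\<^sub>R y - \<epsilon>) \<le> (1 - u) * max 0 (x - \<epsilon>) + u * max 0 (y - \<epsilon>)"
        by linarith
    qed simp
  qed (use assms in simp)
  moreover have "mono_on {t..} (\<lambda>x. (1 / (t - \<epsilon>)) * max 0 (x - \<epsilon>))"
    using assms by (intro mono_onI mult_left_mono) auto
  ultimately show ?thesis using assms by (simp add: F_ic_def)
qed

section \<open>The tail bound\<close>

theorem theorem1p10:
  fixes n :: nat
    and p \<sigma> :: "nat \<Rightarrow> real"
    and M :: "'a measure" and X :: "nat \<Rightarrow> 'a \<Rightarrow> real"
    and N :: "'b measure" and \<xi> :: "nat \<Rightarrow> 'b \<Rightarrow> real"
    and pbar t :: real
  assumes n: "n \<ge> 1"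
    and p: "\<And>i. i \<in> {1..n} \<Longrightarrow> 0 < p i \<and> p i < 1"
    and \<sigma>: "\<And>i. i \<in> {1..n} \<Longrightarrow> \<sigma> i > 0"
    and M: "prob_space M"
    and X_indep: "prob_space.indep_vars M (\<lambda>_. borel) X {1..n}"
    and X_class: "\<And>i. i \<in> {1..n} \<Longrightarrow> X i \<in> class_B M (p i) ((\<sigma> i)\<^sup>2)"
    and pbar: "pbar = (1 / real n) * (\<Sum>i=1..n. prob_space.expectation M (X i))"
    and t: "real n * pbar < t" "t < real n"
    and N: "prob_space N"
    and \<xi>_indep: "prob_space.indep_vars N (\<lambda>_. borel) \<xi> {1..n}"
    and \<xi>_distr: "\<And>i. i \<in> {1..n} \<Longrightarrow> xi_distributed N (\<xi> i) (p i) (\<sigma> i)"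
  shows "measure M {\<omega> \<in> space M. (\<Sum>i=1..n. X i \<omega>) \<ge> t}
           \<le> (INF f \<in> {f \<in> F_ic t. f t > 0}.
                (1 / f t) * prob_space.expectation N (\<lambda>\<omega>. f (\<Sum>i=1..n. \<xi> i \<omega>)))
       \<and> (\<exists>\<epsilon> f. 0 \<le> \<epsilon> \<and> \<epsilon> < t \<and> f = (\<lambda>x. (1 / (t - \<epsilon>)) * max 0 (x - \<epsilon>)) \<and>
            f \<in> F_ic t \<and> f t > 0 \<and>
            (1 / f t) * prob_space.expectation N (\<lambda>\<omega>. f (\<Sum>i=1..n. \<xi> i \<omega>))
              = (INF f \<in> {f \<in> F_ic t. f t > 0}.
                  (1 / f t) * prob_space.expectation N (\<lambda>\<omega>. f (\<Sum>i=1..n. \<xi> i \<omega>))))"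
proof -
  interpret M: prob_space M by fact
  interpret N: prob_space N by fact
  let ?S = "\<lambda>\<omega>. \<Sum>i=1..n. X i \<omega>" and ?Z = "\<lambda>\<omega>. \<Sum>i=1..n. \<xi> i \<omega>"
  let ?\<Phi> = "\<lambda>f. (1 / f t) * N.expectation (\<lambda>\<omega>. f (?Z \<omega>))"
  let ?h = "\<lambda>\<epsilon> x. (1 / (t - \<epsilon>)) * max 0 (x - \<epsilon>)"
  have iX: "integrable M (X i)" and EX: "M.expectation (X i) = p i" if "i \<in> {1..n}" for i
  proof -
    have "X i \<in> borel_measurable M" "AE \<omega> in M. 0 \<le> X i \<omega> \<and> X i \<omega> \<le> 1"
      using X_class[OF that] by (auto simp: class_B_def)
    then show "integrable M (X i)" by (rule M.integrable_continuous_bounded) (rule continuous_on_id)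
    show "M.expectation (X i) = p i" using X_class[OF that] by (simp add: class_B_def)
  qed
  have iS: "integrable M ?S" using iX by (intro Bochner_Integration.integrable_sum) auto
  have sf: "simple_function N (\<xi> i)" and Em: "N.expectation (\<xi> i) = p i" if i: "i \<in> {1..n}" for i
  proof -
    have val: "\<xi> i \<in> borel_measurable N" "\<xi> i ` space N \<subseteq> {0, p i, 1}"
      using \<xi>_distr[OF i] by (auto simp: xi_distributed_def)
    then show "simple_function N (\<xi> i)"
      by (intro simple_function_borel_measurable) (auto intro: finite_subset)
    obtain a b c where abc: "xi_probs (p i) (\<sigma> i) = (a, b, c)" by (cases "xi_probs (p i) (\<sigma> i)")
    have pi: "0 < p i" "p i < 1" using p[OF i] by auto
    have "N.expectation (\<xi> i) = b * p i + c"
      using N.xi_expectation(1)[OF \<xi>_distr[OF i] pi abc, of "\<lambda>x. x"] by simp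
    also have "\<dots> = p i * (a + b + c)"
      using xi_probs_balance[OF pi abc] by (simp add: algebra_simps)
    finally show "N.expectation (\<xi> i) = p i"
      using N.xi_expectation(2)[OF \<xi>_distr[OF i] pi abc] by simp
  qed
  have sfZ: "simple_function N ?Z" using sf by auto
  have fZ: "integrable N (\<lambda>\<omega>. f (?Z \<omega>))" for f :: "real \<Rightarrow> real"
    using sfZ by (intro N.integrable_comp_finite_range borel_measurable_simple_function)
      (auto simp: simple_function_def)
  have iZ: "integrable N ?Z" using fZ[of "\<lambda>x. x"] .
  have Zpos: "0 \<le> ?Z \<omega>" if "\<omega> \<in> space N" for \<omega>
  proof (rule sum_nonneg)
    fix i assume "i \<in> {1..n}"
    then show "0 \<le> \<xi> i \<omega>" using \<xi>_distr[of i] p[of i] that by (force simp: xi_distributed_def)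
  qed
  have "N.expectation ?Z = (\<Sum>i=1..n. p i)"
    using Em sf fZ \<xi>_distr 
    by (subst Bochner_Integration.integral_sum)
       (auto intro!: N.integrable_comp_finite_range[of _ "\<lambda>x. x"] borel_measurable_simple_function
          simp: simple_function_def)
  moreover have "real n * pbar = (\<Sum>i=1..n. p i)" using n EX by (simp add: pbar)
  ultimately have EZ: "N.expectation ?Z < t" using t by simp
  have "0 < (\<Sum>i=1..n. p i)" using n p by (intro sum_pos) auto
  then have tpos: "0 < t" using \<open>real n * pbar = _\<close> t by simp
  have "0 < N.prob {\<omega> \<in> space N. real n \<le> ?Z \<omega>}"
    using N.prob_sum_xi_max_pos[OF _ \<xi>_indep \<xi>_distr p \<sigma>] by simp
  then obtain \<epsilon> where \<epsilon>: "0 \<le> \<epsilon>" "\<epsilon> < t"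
    and min: "\<forall>\<delta>\<in>{0..<t}. stop_loss N ?Z \<epsilon> / (t - \<epsilon>) \<le> stop_loss N ?Z \<delta> / (t - \<delta>)"
    using N.normalized_stop_loss_attains_min[OF iZ tpos t(2)] by blast
  have h: "?h \<epsilon> \<in> {f \<in> F_ic t. f t > 0}" using hinge_mem_F_ic[OF \<epsilon>(2)] \<epsilon> by simp
  have val: "?\<Phi> (?h \<epsilon>) = stop_loss N ?Z \<epsilon> / (t - \<epsilon>)"
    using \<epsilon> by (simp add: stop_loss_def)
  have inf: "(INF f \<in> {f \<in> F_ic t. f t > 0}. ?\<Phi> f) = ?\<Phi> (?h \<epsilon>)"
  proof (rule cInf_eq_minimum)
    show "?\<Phi> (?h \<epsilon>) \<in> ?\<Phi> ` {f \<in> F_ic t. f t > 0}" using h by (rule imageI)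
    fix y assume "y \<in> ?\<Phi> ` {f \<in> F_ic t. f t > 0}"
    then obtain f where f: "convex_on {0..} f" "\<forall>x\<ge>0. 0 \<le> f x" "0 < f t" and y: "y = ?\<Phi> f"
      by (auto simp: F_ic_def)
    obtain \<delta> where "0 \<le> \<delta>" "\<delta> < t" "stop_loss N ?Z \<delta> / (t - \<delta>) \<le> ?\<Phi> f"
      using N.normalized_stop_loss_le_convex[OF iZ Zpos EZ f tpos fZ] by blast
    then show "?\<Phi> (?h \<epsilon>) \<le> y" unfolding val y using min by force
  qed
  have "M.prob {\<omega> \<in> space M. ?S \<omega> \<ge> t} \<le> stop_loss M ?S \<epsilon> / (t - \<epsilon>)"
    using iS \<epsilon>(2) by (rule M.prob_ge_le_stop_loss)
  also have "\<dots> \<le> stop_loss N ?Z \<epsilon> / (t - \<epsilon>)"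
    using stop_loss_sum_le[OF M N _ X_indep \<xi>_indep X_class \<xi>_distr p \<sigma>] \<epsilon>
    by (intro divide_right_mono) auto
  finally have "M.prob {\<omega> \<in> space M. ?S \<omega> \<ge> t} \<le> ?\<Phi> (?h \<epsilon>)" unfolding val .
  then show ?thesis unfolding inf using \<epsilon> h by blast
qed

end
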